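(* A Collatz sequence does not increase monotonically: for every positive integer $A$, if $a_0,a_1,a_2,\dots$ is the subsequence of odd terms of the Collatz sequence of $A$, then there is no $N\ge 0$ such that $a_{i+1}>a_i$ for all $i\ge N$.
   Context: For a positive integer $A$, the Collatz sequence of $A$ is the sequence $(c_i)_{i\ge 0}$ with $c_0=A$ and, for $i\ge 1$, $c_i=3c_{i-1}+1$ if $c_{i-1}$ is odd and $c_i=c_{i-1}/2$ if $c_{i-1}$ is even. The subsequence of odd terms lists the odd $c_i$ in order of occurrence (it is infinite; if $1$ is reached, it is $1$ from then on). If $a$ and $b$ are consecutive terms of the odd subsequence ($b$ immediately after $a$), the Collatz sequence is said to increase at $a$ if $b>a$, and to decrease at $a$ otherwise. *)

theory Defs
  imports Main "HOL-Library.Infinite_Set"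
begin

fun collatz :: "nat \<Rightarrow> nat \<Rightarrow> nat" where
  "collatz A 0 = A"
| "collatz A (Suc i) =
     (if odd (collatz A i) then 3 * collatz A i + 1 else collatz A i div 2)"

text \<open>\<open>enumerate S n\<close> is the n-th smallest element (from 0) of an infinite set \<open>S\<close>. For
  \<open>A > 0\<close> the set of indices below is infinite, see \<open>infinite_odd_indices\<close>.\<close>

definition odd_terms :: "nat \<Rightarrow> nat \<Rightarrow> nat" where
  "odd_terms A n = collatz A (enumerate {i. odd (collatz A i)} n)"

lemma collatz_pos: "A > 0 \<Longrightarrow> collatz A i > 0"
  by (induction i) (auto elim!: evenE)

lemma ex_odd_collatz:
  assumes "A > 0"
  shows "\<exists>j\<ge>i. odd (collatz A j)"
proof (induction "collatz A i" arbitrary: i rule: less_induct)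
  case less
  show ?case
  proof (cases "odd (collatz A i)")
    case False
    then have "collatz A (Suc i) < collatz A i"
      using collatz_pos[OF assms, of i] by simp
    then show ?thesis
      using less[of "Suc i"] Suc_leD by blast
  qed blast
qed

lemma infinite_odd_indices:
  assumes "A > 0"
  shows "infinite {i. odd (collatz A i)}"
  using ex_odd_collatz[OF assms] by (simp add: infinite_nat_iff_unbounded_le)

end

theory Submission
  imports Defs
begin

text \<open>
  If \<open>a\<close>, \<open>b\<close> are consecutive odd terms, then \<open>b = (3 * a + 1) / 2 ^ k\<close> with \<open>k \<ge> 1\<close>, and
  \<open>b > a\<close> forces \<open>k = 1\<close>, that is \<open>2 * (b + 1) = 3 * (a + 1)\<close>. If the sequence increased from
  index \<open>N\<close> on, iterating this would make \<open>a\<^sub>N + 1\<close> divisible by every power of \<open>2\<close>.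
\<close>

text \<open>Every step from an even value halves it. The value at \<open>j\<close> may be odd, so
  \<open>j\<close> can be the index of the next odd term.\<close>

lemma collatz_even_run_le:
  assumes "i \<le> j" "\<And>l. i \<le> l \<Longrightarrow> l < j \<Longrightarrow> even (collatz A l)"
  shows "collatz A j \<le> collatz A i"
  using assms
proof (induction j rule: dec_induct)
  case (step n)
  then have "collatz A n \<le> collatz A i" "even (collatz A n)"
    by simp_all
  then show ?case
    by simp
qed simp

lemma odd_terms_increase:
  assumes "A > 0" and increase: "odd_terms A n < odd_terms A (Suc n)"
  shows "2 * odd_terms A (Suc n) = 3 * odd_terms A n + 1"
proof -
  define S where "S = {i. odd (collatz A i)}"
  define i where "i = enumerate S n"
  define j where "j = enumerate S (Suc n)"
  have inf: "infinite S"
    unfolding S_def using infinite_odd_indices[OF assms(1)] .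
  have odd_i: "odd (collatz A i)" and odd_j: "odd (collatz A j)"
    using enumerate_in_set[OF inf] by (auto simp: i_def j_def S_def)
  have "i < j"
    unfolding i_def j_def using enumerate_step[OF inf] .
  \<comment> \<open>\<open>enumerate\<close> picks the least element of \<open>S\<close> above
    \<open>i\<close> as \<open>j\<close>, so no index strictly between them lies in
    \<open>S\<close>.\<close>
  have gap: "even (collatz A l)" if "i < l" "l < j" for l
  proof -
    have "l < (LEAST s. s \<in> S \<and> enumerate S n < s)"
      using that(2) enumerate_Suc''[OF inf, of n] by (simp add: j_def)
    from not_less_Least[OF this] that(1) show ?thesis
      by (simp add: i_def S_def)
  qed
  have c1: "collatz A (Suc i) = 3 * collatz A i + 1" and even1: "even (collatz A (Suc i))"
    using odd_i by simp_all
  have c2: "2 * collatz A (Suc (Suc i)) = 3 * collatz A i + 1"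
    using even1 c1 by (metis collatz.simps(2) dvd_mult_div_cancel)
  have "j \<noteq> Suc i"
    using odd_j even1 by metis
  with \<open>i < j\<close> have "Suc (Suc i) \<le> j"
    by simp
  have increase': "collatz A i < collatz A j"
    using increase by (simp add: odd_terms_def i_def j_def S_def)
  \<comment> \<open>Otherwise a second halving follows. With a = \<open>collatz A i\<close>, it
    yields (3 * a + 1) / 4, which is at most a because a is at least 1; the remaining halvings up to
    \<open>j\<close> cannot undo this.\<close>
  have "j = Suc (Suc i)"
  proof (rule ccontr)
    assume "j \<noteq> Suc (Suc i)"
    with \<open>Suc (Suc i) \<le> j\<close> have "Suc (Suc (Suc i)) \<le> j"
      by simp
    then have "collatz A j \<le> collatz A (Suc (Suc (Suc i)))"
      by (rule collatz_even_run_le) (rule gap, simp_all)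
    also have "even (collatz A (Suc (Suc i)))"
      using \<open>Suc (Suc (Suc i)) \<le> j\<close> by (intro gap) simp_all
    then have "collatz A (Suc (Suc (Suc i))) = collatz A (Suc (Suc i)) div 2"
      by (metis collatz.simps(2))
    also have "\<dots> \<le> collatz A i"
      using c2 odd_pos[OF odd_i] by linarith
    finally show False
      using increase' by simp
  qed
  with c2 show ?thesis
    by (simp add: odd_terms_def flip: S_def i_def j_def)
qed

theorem corollary3:
  fixes A :: nat
  assumes "A > 0"
  shows "\<not> (\<exists>N. \<forall>i\<ge>N. odd_terms A (Suc i) > odd_terms A i)"
proof
  assume "\<exists>N. \<forall>i\<ge>N. odd_terms A (Suc i) > odd_terms A i"
  then obtain N where N: "\<And>i. i \<ge> N \<Longrightarrow> odd_terms A i < odd_terms A (Suc i)"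
    by blast
  \<comment> \<open>Adding 1 to each term turns the affine recursion into pure multiplication by
    3/2, which iterates; clearing denominators keeps it in the naturals.\<close>
  have pow: "2 ^ k * (odd_terms A (N + k) + 1) = 3 ^ k * (odd_terms A N + 1)" for k
  proof (induction k)
    case (Suc k)
    have "2 * (odd_terms A (N + Suc k) + 1) = 3 * (odd_terms A (N + k) + 1)"
      using odd_terms_increase[OF assms N[of "N + k"]] by simp
    then have "2 ^ Suc k * (odd_terms A (N + Suc k) + 1)
        = 3 * (2 ^ k * (odd_terms A (N + k) + 1))"
      by (metis mult.assoc mult.left_commute power_Suc2)
    also have "\<dots> = 3 ^ Suc k * (odd_terms A N + 1)"
      unfolding Suc.IH by (simp only: power_Suc mult.assoc)
    finally show ?case .
  qed simp
  \<comment> \<open>Taking the exponent equal to the number to be divided makes the contradiction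
    just k < 2 ^ k; k is positive, so a divisor of it is at most k.\<close>
  define k where "k = odd_terms A N + 1"
  have "coprime (2 ^ k :: nat) (3 ^ k)"
    by (simp add: coprime_power_left_iff coprime_power_right_iff)
  moreover have "2 ^ k dvd 3 ^ k * k"
    using pow[of k] unfolding k_def by (metis dvd_triv_left)
  ultimately have "2 ^ k dvd k"
    by (simp add: coprime_dvd_mult_right_iff)
  then have "2 ^ k \<le> k"
    by (rule dvd_imp_le) (simp add: k_def)
  then show False
    using less_exp[of k] by simp
qed

end
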